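(* Let $G$ be a finite simple graph on $n\ge1$ vertices and let $v\in V(G)$. Let $p_G(v)$ be the probability that $v$ is selected as a pivot in the Caro--Wei process on $G$, and for an edge $vu\in E(G)$ let $q_G(vu)$ be the probability that $v$ and $u$ lie in different blocks of the Caro--Wei process on $G$. Then $$\frac1{p_G(v)}+\sum_{u\in N_G(v)}\frac1{q_G(vu)}\le n.$$
   Context: Graphs are finite and simple; $N_G(v)$ denotes the open neighborhood of $v$ in $G$ (so $v\notin N_G(v)$). Caro--Wei process: given a graph $G$, choose a uniformly random ordering of $V(G)$. Start with $S_0=V(G)$. As long as $S_i\neq\varnothing$, let $x_i$ be the first vertex of $S_i$ in the chosen order, called a pivot, and set $S_{i+1}=S_i\cap N_G(x_i)$ and $B_i=S_i\setminus S_{i+1}$. Stop when $S_i=\varnothing$. The sets $B_0,B_1,\ldots$ are the blocks of the process; in every outcome they form a partition of $V(G)$. For $v\in V(G)$ and $uv\in E(G)$ define $$p_G(v)=\Pr(v\text{ is selected as a pivot}),\qquad q_G(uv)=\Pr(u\text{ and }v\text{ lie in different blocks}),$$ the probabilities being over the uniformly random ordering of $V(G)$. *)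

theory Defs
  imports "HOL-Probability.Probability" "HOL-Combinatorics.Multiset_Permutations"
begin

definition finite_simple_graph :: "'a set \<Rightarrow> 'a set set \<Rightarrow> bool" where
  "finite_simple_graph V E \<longleftrightarrow> finite V \<and> (\<forall>e\<in>E. e \<subseteq> V \<and> card e = 2)"

definition nbhd :: "'a set set \<Rightarrow> 'a \<Rightarrow> 'a set" where
  "nbhd E v = {u. {v, u} \<in> E}"

text \<open>An ordering of \<^term>\<open>V\<close> is an element of \<^term>\<open>permutations_of_set V\<close>, that is, a
  repetition-free list \<^term>\<open>xs\<close> of the elements of \<^term>\<open>V\<close>.\<close>

definition first_in :: "'a list \<Rightarrow> 'a set \<Rightarrow> 'a" where
  "first_in xs S = hd (filter (\<lambda>x. x \<in> S) xs)"

text \<open>The sequence is total: once it reaches the empty set it stays there. Stopping of the process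
  is expressed by the condition \<^term>\<open>cw_set V E xs i \<noteq> {}\<close> on the indices that count below;
  \<^term>\<open>cw_pivot V E xs i\<close> is meaningful only for these indices.\<close>

primrec cw_set :: "'a set \<Rightarrow> 'a set set \<Rightarrow> 'a list \<Rightarrow> nat \<Rightarrow> 'a set" where
  "cw_set V E xs 0 = V"
| "cw_set V E xs (Suc i) = cw_set V E xs i \<inter> nbhd E (first_in xs (cw_set V E xs i))"

definition cw_pivot :: "'a set \<Rightarrow> 'a set set \<Rightarrow> 'a list \<Rightarrow> nat \<Rightarrow> 'a" where
  "cw_pivot V E xs i = first_in xs (cw_set V E xs i)"

definition cw_block :: "'a set \<Rightarrow> 'a set set \<Rightarrow> 'a list \<Rightarrow> nat \<Rightarrow> 'a set" where
  "cw_block V E xs i = cw_set V E xs i - cw_set V E xs (Suc i)"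

definition cw_pivots :: "'a set \<Rightarrow> 'a set set \<Rightarrow> 'a list \<Rightarrow> 'a set" where
  "cw_pivots V E xs = {cw_pivot V E xs i | i. cw_set V E xs i \<noteq> {}}"

definition cw_blocks :: "'a set \<Rightarrow> 'a set set \<Rightarrow> 'a list \<Rightarrow> 'a set set" where
  "cw_blocks V E xs = {cw_block V E xs i | i. cw_set V E xs i \<noteq> {}}"

definition random_ordering :: "'a set \<Rightarrow> 'a list pmf" where
  "random_ordering V = pmf_of_set (permutations_of_set V)"

definition pivot_prob :: "'a set \<Rightarrow> 'a set set \<Rightarrow> 'a \<Rightarrow> real" where
  "pivot_prob V E v = measure_pmf.prob (random_ordering V) {xs. v \<in> cw_pivots V E xs}"

definition sep_prob :: "'a set \<Rightarrow> 'a set set \<Rightarrow> 'a \<Rightarrow> 'a \<Rightarrow> real" where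
  "sep_prob V E u v = measure_pmf.prob (random_ordering V)
     {xs. \<exists>A\<in>cw_blocks V E xs. \<exists>B\<in>cw_blocks V E xs. u \<in> A \<and> v \<in> B \<and> A \<noteq> B}"

end

theory Submission imports Defs begin

text \<open>
  Condition on the first pivot \<open>x\<close>; the rest is the process on the subgraph induced by \<open>N(x)\<close>. With
  \<open>N = N(v)\<close>, \<open>d = card N\<close>, \<open>m x = card (N(x) - N)\<close>, \<open>p x\<close> the pivot probability of \<open>v\<close> in \<open>N(x)\<close>, and
  \<open>q x u\<close> the separation probability of \<open>v, u\<close> in \<open>N(x)\<close> (or 1 if \<open>x\<close> is not adjacent to \<open>u\<close>), this gives
  \<open>n p(v) = 1 + (\<Sum>x\<in>N. p x)\<close> and \<open>n q(vu) = m u + (\<Sum>x\<in>N. q x u)\<close>, while induction gives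
  \<open>1 / p x + (\<Sum>u\<in>N. 1 / q x u) \<le> m x + d\<close>. The claim becomes a concave maximisation problem in the
  \<open>1 / p x\<close> and \<open>1 / q x u \<ge> 1\<close>. Its dual certificate is the solution \<open>r\<close> of
  \<open>m x * r x + (\<Sum>y\<in>N. min (r x) (r y)) = 1\<close>: the Cauchy-Schwarz inequality with weights \<open>r x\<close> for
  \<open>p x\<close> and \<open>min (r u) (r x)\<close> for \<open>q x u\<close> bounds the maximum by exactly 1.
\<close>

section \<open>The optimisation step\<close>

text \<open>Cauchy-Schwarz in quotient form, with numerators \<open>c * s\<close> over
  \<open>c\<close> and \<open>w i\<close> over \<open>y i\<close>, normalised to total 1. Each
  quotient is bounded below by its tangent at the equality case.\<close>

lemma inverse_add_sum_le:
  fixes y w :: "'a \<Rightarrow> real"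
  assumes "finite I" and "c > 0" and y: "\<And>i. i \<in> I \<Longrightarrow> y i > 0"
    and w: "c * s + (\<Sum>i\<in>I. w i) = 1"
  shows "1 / (c + (\<Sum>i\<in>I. y i)) \<le> c * s\<^sup>2 + (\<Sum>i\<in>I. (w i)\<^sup>2 / y i)"
proof -
  \<comment> \<open>Equality forces \<open>s\<close> and all ratios \<open>w i / y i\<close> to
    agree; \<open>T\<close> is that common ratio.\<close>
  define T where "T = 1 / (c + (\<Sum>i\<in>I. y i))"
  have "(\<Sum>i\<in>I. y i) \<ge> 0"
    using y by (intro sum_nonneg) (auto intro: less_imp_le)
  then have T: "T * (c + (\<Sum>i\<in>I. y i)) = 1"
    using \<open>c > 0\<close> by (simp add: T_def)
  have "2 * T * w i - T\<^sup>2 * y i \<le> (w i)\<^sup>2 / y i" if "i \<in> I" for i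
  proof -
    have "0 \<le> (w i - T * y i)\<^sup>2 / y i"
      using y[OF that] by simp
    also have "\<dots> = (w i)\<^sup>2 / y i - (2 * T * w i - T\<^sup>2 * y i)"
      using y[OF that] by (simp add: field_simps power2_eq_square)
    finally show ?thesis by simp
  qed
  then have 1: "(\<Sum>i\<in>I. 2 * T * w i - T\<^sup>2 * y i) \<le> (\<Sum>i\<in>I. (w i)\<^sup>2 / y i)"
    by (rule sum_mono)
  have "0 \<le> c * (s - T)\<^sup>2"
    using \<open>c > 0\<close> by simp
  then have 2: "2 * T * (c * s) - T\<^sup>2 * c \<le> c * s\<^sup>2"
    by (simp add: power2_eq_square algebra_simps)
  have "2 * T * (c * s) - T\<^sup>2 * c + (\<Sum>i\<in>I. 2 * T * w i - T\<^sup>2 * y i)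
      = 2 * T * (c * s + (\<Sum>i\<in>I. w i)) - T * (T * (c + (\<Sum>i\<in>I. y i)))"
    by (simp add: sum_subtractf sum_distrib_left[symmetric] power2_eq_square algebra_simps)
      (simp add: sum_distrib_left[symmetric] sum_distrib_right[symmetric])
  also have "\<dots> = T"
    unfolding w T by simp
  finally show ?thesis
    using 1 2 unfolding T_def by linarith
qed

text \<open>The solution is built from the largest \<open>m x\<close> down, which yields the values \<open>r x\<close> in increasing
  order; the lower bound is the invariant that keeps them increasing.\<close>

lemma ex_min_balanced:
  fixes m :: "'a \<Rightarrow> real"
  assumes "finite N" and "\<And>x. x \<in> N \<Longrightarrow> m x > 0" and "C \<ge> 0"
  shows "\<exists>r. (\<forall>x\<in>N. m x * r x + (\<Sum>y\<in>N. min (r x) (r y)) = C)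
    \<and> (\<forall>M. (\<forall>x\<in>N. m x \<le> M) \<longrightarrow> (\<forall>x\<in>N. C / (M + card N) \<le> r x))"
  using assms
proof (induction N arbitrary: C rule: finite_ranking_induct[where f = m])
  case empty
  then show ?case by simp
next
  case (insert x N)
  show ?case
  proof (cases "x \<in> N")
    case True
    then show ?thesis
      using insert.IH[of C] insert.prems by (simp add: insert_absorb)
  next
    case False
    define k where "k = real (card N)"
    \<comment> \<open>As \<open>x\<close> gets the smallest value, every minimum in its equation is
      \<rho>, leaving \<open>m x * \<rho> + (k + 1) * \<rho> = C\<close>. In the equations of the
      other vertices \<open>x\<close> contributes \<rho>, so they must be solved with constant
      \<open>C - \<rho>\<close>.\<close>
    define \<rho> where "\<rho> = C / (m x + k + 1)"
    have mx: "m x > 0" and k: "k \<ge> 0"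
      using insert.prems by (auto simp: k_def)
    have \<rho>: "\<rho> \<ge> 0" and \<rho>_eq: "C - \<rho> = \<rho> * (m x + k)"
      using mx k \<open>C \<ge> 0\<close> by (auto simp: \<rho>_def field_simps)
    then have "C - \<rho> \<ge> 0"
      using mx k by simp
    with insert.IH[of "C - \<rho>"] insert.prems have "\<exists>r.
        (\<forall>y\<in>N. m y * r y + (\<Sum>z\<in>N. min (r y) (r z)) = C - \<rho>)
        \<and> (\<forall>M. (\<forall>x\<in>N. m x \<le> M) \<longrightarrow> (\<forall>y\<in>N. (C - \<rho>) / (M + k) \<le> r y))"
      unfolding k_def by simp
    then obtain r where
      eq: "\<And>y. y \<in> N \<Longrightarrow> m y * r y + (\<Sum>z\<in>N. min (r y) (r z)) = C - \<rho>" and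
      low: "\<And>M y. (\<forall>x\<in>N. m x \<le> M) \<Longrightarrow> y \<in> N \<Longrightarrow> (C - \<rho>) / (M + k) \<le> r y"
      by metis
    \<comment> \<open>\<open>m x\<close> bounds \<open>m\<close> on \<open>N\<close> by the ranking,
      and the lower bound for \<open>M = m x\<close> is exactly \<rho>.\<close>
    have \<rho>_le: "\<rho> \<le> r y" if "y \<in> N" for y
      using low[OF _ that, of "m x"] insert.hyps mx k by (simp add: \<rho>_eq)
    define r' where "r' = r(x := \<rho>)"
    have r'x: "r' x = \<rho>" and r': "\<And>y. y \<in> N \<Longrightarrow> r' y = r y"
      using False by (auto simp: r'_def)
    have "m y * r' y + (\<Sum>z\<in>insert x N. min (r' y) (r' z)) = C" if "y \<in> insert x N" for y
    proof (cases "y = x")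
      case True
      have "(\<Sum>z\<in>N. min \<rho> (r' z)) = (\<Sum>z\<in>N. \<rho>)"
        by (rule sum.cong) (use \<rho>_le r' in auto)
      then show ?thesis
        using True False insert.hyps \<rho>_eq by (simp add: r'x k_def algebra_simps)
    next
      case neq: False
      with that have y: "y \<in> N" by simp
      have "(\<Sum>z\<in>N. min (r' y) (r' z)) = (\<Sum>z\<in>N. min (r y) (r z))"
        by (rule sum.cong) (use y r' in auto)
      then show ?thesis
        using False insert.hyps eq[OF y] \<rho>_le[OF y] r'[OF y] by (simp add: r'x min_absorb2)
    qed
    moreover have "C / (M + card (insert x N)) \<le> r' y"
      if M: "\<forall>x\<in>insert x N. m x \<le> M" and y: "y \<in> insert x N" for M y
    proof -
      have "C / (M + card (insert x N)) \<le> \<rho>"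
        unfolding \<rho>_def using M mx k False insert.hyps \<open>C \<ge> 0\<close>
        by (intro divide_left_mono) (auto simp: k_def)
      also have "\<rho> \<le> r' y"
        using y \<rho>_le r' r'x by auto
      finally show ?thesis .
    qed
    ultimately show ?thesis by blast
  qed
qed

text \<open>Adding the sum with its indices swapped reduces this to
  \<open>(a + b) * min a b = (min a b)^2 + a * b\<close>, as the product of minimum and maximum is
  \<open>a * b\<close>.\<close>

lemma sum_mult_min_symmetrise:
  fixes r :: "'a \<Rightarrow> real"
  shows "2 * (\<Sum>x\<in>N. \<Sum>y\<in>N. r x * min (r x) (r y))
    = (\<Sum>x\<in>N. \<Sum>y\<in>N. (min (r x) (r y))\<^sup>2) + (\<Sum>x\<in>N. r x)\<^sup>2"
proof -
  have "(\<Sum>x\<in>N. \<Sum>y\<in>N. r x * min (r x) (r y)) = (\<Sum>x\<in>N. \<Sum>y\<in>N. r y * min (r x) (r y))"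
    by (subst sum.swap) (simp add: min.commute)
  then have "2 * (\<Sum>x\<in>N. \<Sum>y\<in>N. r x * min (r x) (r y))
      = (\<Sum>x\<in>N. \<Sum>y\<in>N. r x * min (r x) (r y) + r y * min (r x) (r y))"
    by (simp add: sum.distrib)
  also have "\<dots> = (\<Sum>x\<in>N. \<Sum>y\<in>N. (min (r x) (r y))\<^sup>2 + r x * r y)"
    by (intro sum.cong) (auto simp: min_def power2_eq_square)
  also have "\<dots> = (\<Sum>x\<in>N. \<Sum>y\<in>N. (min (r x) (r y))\<^sup>2) + (\<Sum>x\<in>N. r x)\<^sup>2"
    by (simp add: sum.distrib power2_eq_square sum_product)
  finally show ?thesis .
qed

text \<open>Weak duality: Cauchy-Schwarz makes the left side linear in the reciprocals
  \<open>1 / p x\<close> and \<open>1 / q x u\<close>, and the budget of \<open>x\<close> is then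
  applied with multiplier \<open>(r x)^2\<close>.\<close>

lemma sum_inverse_le_one:
  fixes m p :: "'a \<Rightarrow> real" and q :: "'a \<Rightarrow> 'a \<Rightarrow> real"
  assumes "finite N" and m: "\<And>x. x \<in> N \<Longrightarrow> m x > 0" and p: "\<And>x. x \<in> N \<Longrightarrow> p x > 0"
    and q: "\<And>x u. x \<in> N \<Longrightarrow> u \<in> N \<Longrightarrow> q x u > 0"
    and q_le: "\<And>x u. x \<in> N \<Longrightarrow> u \<in> N \<Longrightarrow> q x u \<le> 1"
    and budget: "\<And>x. x \<in> N \<Longrightarrow> 1 / p x + (\<Sum>u\<in>N. 1 / q x u) \<le> m x + card N"
  shows "1 / (1 + (\<Sum>x\<in>N. p x)) + (\<Sum>u\<in>N. 1 / (m u + (\<Sum>x\<in>N. q x u))) \<le> 1"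
proof -
  obtain r where
    r_eq: "\<And>x. x \<in> N \<Longrightarrow> m x * r x + (\<Sum>y\<in>N. min (r x) (r y)) = 1" and
    r_low: "\<And>M x. (\<forall>x\<in>N. m x \<le> M) \<Longrightarrow> x \<in> N \<Longrightarrow> 1 / (M + card N) \<le> r x"
    using ex_min_balanced[OF \<open>finite N\<close>, of m 1] m by (metis zero_le_one)
  have r: "r x \<ge> 0" if "x \<in> N" for x
  proof -
    have "Max (m ` N) \<ge> m x"
      using that \<open>finite N\<close> by simp
    then have "0 \<le> 1 / (Max (m ` N) + card N)"
      using m[OF that] by simp
    also have "\<dots> \<le> r x"
      using r_low[OF _ that] \<open>finite N\<close> by simp
    finally show ?thesis .
  qed
  define R where "R = (\<Sum>x\<in>N. r x)"
  \<comment> \<open>The summand 1 takes the weight \<open>1 - R\<close> that remains after the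
    weights \<open>r x\<close>; in the next bound \<open>r_eq\<close> is the normalisation.\<close>
  have 1: "1 / (1 + (\<Sum>x\<in>N. p x)) \<le> (1 - R)\<^sup>2 + (\<Sum>x\<in>N. (r x)\<^sup>2 / p x)"
    using inverse_add_sum_le[of N 1 p "1 - R" r] p \<open>finite N\<close> by (simp add: R_def)
  have 2: "1 / (m u + (\<Sum>x\<in>N. q x u))
      \<le> m u * (r u)\<^sup>2 + (\<Sum>x\<in>N. (min (r u) (r x))\<^sup>2 / q x u)" if "u \<in> N" for u
    using that m q r_eq \<open>finite N\<close> by (intro inverse_add_sum_le) auto
  have 3: "(r x)\<^sup>2 / p x + (\<Sum>u\<in>N. (min (r u) (r x))\<^sup>2 / q x u)
      \<le> m x * (r x)\<^sup>2 + (\<Sum>u\<in>N. (min (r x) (r u))\<^sup>2)" if x: "x \<in> N" for x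
  proof -
    \<comment> \<open>Only the excess \<open>1 / q x u - 1 >= 0\<close> has its coefficient raised
      to \<open>(r x)^2\<close>; raising it on the whole term would be too lossy.\<close>
    have "(min (r u) (r x))\<^sup>2 / q x u \<le> (min (r x) (r u))\<^sup>2 + (r x)\<^sup>2 * (1 / q x u - 1)"
      if u: "u \<in> N" for u
    proof -
      have "(min (r x) (r u))\<^sup>2 \<le> (r x)\<^sup>2"
        using r x u by (intro power_mono) auto
      moreover have "1 / q x u - 1 \<ge> 0"
        using q[OF x u] q_le[OF x u] by simp
      ultimately have "(min (r x) (r u))\<^sup>2 * (1 / q x u - 1) \<le> (r x)\<^sup>2 * (1 / q x u - 1)"
        by (rule mult_right_mono)
      then show ?thesis
        by (simp add: algebra_simps min.commute)
    qed
    then have "(\<Sum>u\<in>N. (min (r u) (r x))\<^sup>2 / q x u)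
        \<le> (\<Sum>u\<in>N. (min (r x) (r u))\<^sup>2 + (r x)\<^sup>2 * (1 / q x u - 1))"
      by (rule sum_mono)
    also have "\<dots> = (\<Sum>u\<in>N. (min (r x) (r u))\<^sup>2) + (r x)\<^sup>2 * ((\<Sum>u\<in>N. 1 / q x u) - card N)"
      by (simp add: sum.distrib sum_distrib_left[symmetric] sum_subtractf)
    finally have "(r x)\<^sup>2 / p x + (\<Sum>u\<in>N. (min (r u) (r x))\<^sup>2 / q x u)
        \<le> (\<Sum>u\<in>N. (min (r x) (r u))\<^sup>2)
          + (r x)\<^sup>2 * (1 / p x + (\<Sum>u\<in>N. 1 / q x u) - card N)"
      by (simp add: algebra_simps)
    also have "(r x)\<^sup>2 * (1 / p x + (\<Sum>u\<in>N. 1 / q x u) - card N) \<le> (r x)\<^sup>2 * m x"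
      using budget[OF x] by (intro mult_left_mono) auto
    finally show ?thesis
      by (simp add: mult.commute)
  qed
  have "1 / (1 + (\<Sum>x\<in>N. p x)) + (\<Sum>u\<in>N. 1 / (m u + (\<Sum>x\<in>N. q x u)))
      \<le> (1 - R)\<^sup>2 + (\<Sum>x\<in>N. (r x)\<^sup>2 / p x)
        + (\<Sum>u\<in>N. m u * (r u)\<^sup>2 + (\<Sum>x\<in>N. (min (r u) (r x))\<^sup>2 / q x u))"
    by (intro add_mono 1 sum_mono 2)
  also have "\<dots> = (1 - R)\<^sup>2 + (\<Sum>u\<in>N. m u * (r u)\<^sup>2)
        + (\<Sum>x\<in>N. (r x)\<^sup>2 / p x + (\<Sum>u\<in>N. (min (r u) (r x))\<^sup>2 / q x u))"
    by (simp add: sum.distrib) (rule sum.swap)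
  also have "\<dots> \<le> (1 - R)\<^sup>2 + (\<Sum>u\<in>N. m u * (r u)\<^sup>2)
        + (\<Sum>x\<in>N. m x * (r x)\<^sup>2 + (\<Sum>u\<in>N. (min (r x) (r u))\<^sup>2))"
    by (intro add_left_mono sum_mono 3)
  also have "\<dots> = (1 - R)\<^sup>2 + 2 * (\<Sum>x\<in>N. m x * (r x)\<^sup>2)
        + (\<Sum>x\<in>N. \<Sum>u\<in>N. (min (r x) (r u))\<^sup>2)"
    by (simp add: sum.distrib)
  also have "(\<Sum>x\<in>N. m x * (r x)\<^sup>2) = (\<Sum>x\<in>N. r x - (\<Sum>y\<in>N. r x * min (r x) (r y)))"
  proof (rule sum.cong)
    fix x assume "x \<in> N"
    have "m x * (r x)\<^sup>2 = r x * (m x * r x)"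
      by (simp add: power2_eq_square)
    also have "m x * r x = 1 - (\<Sum>y\<in>N. min (r x) (r y))"
      using r_eq[OF \<open>x \<in> N\<close>] by simp
    finally show "m x * (r x)\<^sup>2 = r x - (\<Sum>y\<in>N. r x * min (r x) (r y))"
      by (simp add: right_diff_distrib sum_distrib_left)
  qed simp
  also have "\<dots> = R - (\<Sum>x\<in>N. \<Sum>y\<in>N. r x * min (r x) (r y))"
    by (simp add: sum_subtractf R_def)
  \<comment> \<open>By the symmetrised identity the double sums combine to \<open>- R^2\<close>,
    which cancels all but the 1.\<close>
  also have "(1 - R)\<^sup>2 + 2 * (R - (\<Sum>x\<in>N. \<Sum>y\<in>N. r x * min (r x) (r y)))
      + (\<Sum>x\<in>N. \<Sum>u\<in>N. (min (r x) (r u))\<^sup>2) = 1"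
    using sum_mult_min_symmetrise[of r N] by (simp add: R_def power2_eq_square algebra_simps)
  finally show ?thesis .
qed

section \<open>Recursion for the process\<close>

definition separated :: "'a set \<Rightarrow> 'a set set \<Rightarrow> 'a list \<Rightarrow> 'a \<Rightarrow> 'a \<Rightarrow> bool" where
  "separated S E xs u v \<longleftrightarrow>
    (\<exists>A\<in>cw_blocks S E xs. \<exists>B\<in>cw_blocks S E xs. u \<in> A \<and> v \<in> B \<and> A \<noteq> B)"

lemma nbhd_commute: "u \<in> nbhd E v \<longleftrightarrow> v \<in> nbhd E u"
  by (simp add: nbhd_def insert_commute)

lemma first_in_mem:
  assumes "S \<subseteq> set xs" and "S \<noteq> {}"
  shows "first_in xs S \<in> S"
proof -
  have "filter (\<lambda>x. x \<in> S) xs \<noteq> []"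
    using assms by (auto simp: filter_empty_conv)
  then have "first_in xs S \<in> set (filter (\<lambda>x. x \<in> S) xs)"
    unfolding first_in_def by (rule hd_in_set)
  then show ?thesis by simp
qed

lemma first_in_filter:
  assumes "T \<subseteq> S"
  shows "first_in (filter (\<lambda>x. x \<in> S) xs) T = first_in xs T"
proof -
  have "(\<lambda>x. x \<in> S \<and> x \<in> T) = (\<lambda>x. x \<in> T)"
    using assms by auto
  then show ?thesis
    by (simp add: first_in_def)
qed

lemma cw_set_subset: "cw_set S E xs i \<subseteq> S"
  by (induction i) auto

text \<open>The process on \<open>S\<close> sees only the relative order of \<open>S\<close>. This
  later allows an ordering of a larger set to be restricted to \<open>S\<close>.\<close>

lemma cw_set_filter: "cw_set S E (filter (\<lambda>x. x \<in> S) xs) i = cw_set S E xs i"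
  by (induction i) (simp_all add: first_in_filter[OF cw_set_subset])

text \<open>The definition peels off the last step; conditioning on the first pivot requires peeling
  off the first one, with the same list \<open>xs\<close>.\<close>

lemma cw_set_Suc_shift:
  "cw_set S E xs (Suc i) = cw_set (S \<inter> nbhd E (first_in xs S)) E xs i"
proof (induction i)
  case (Suc i)
  have "cw_set S E xs (Suc (Suc i))
      = cw_set S E xs (Suc i) \<inter> nbhd E (first_in xs (cw_set S E xs (Suc i)))"
    by (rule cw_set.simps(2))
  then show ?case
    unfolding Suc by simp
qed simp

lemma cw_pivots_filter: "cw_pivots S E (filter (\<lambda>x. x \<in> S) xs) = cw_pivots S E xs"
  unfolding cw_pivots_def cw_pivot_def cw_set_filter first_in_filter[OF cw_set_subset] ..

lemma separated_filter: "separated S E (filter (\<lambda>x. x \<in> S) xs) u v = separated S E xs u v"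
  unfolding separated_def cw_blocks_def cw_block_def cw_set_filter ..

lemma Collect_index_shift:
  "{f i | i. P i} = {f 0 | i::nat. P 0} \<union> {f (Suc i) | i. P (Suc i)}"
  (is "?L = ?R")
proof
  show "?L \<subseteq> ?R"
  proof
    fix x assume "x \<in> ?L"
    then obtain i where "x = f i" "P i" by blast
    then show "x \<in> ?R" by (cases i) auto
  qed
qed auto

lemma cw_pivots_rec:
  assumes "S \<noteq> {}"
  shows "cw_pivots S E xs
    = insert (first_in xs S) (cw_pivots (S \<inter> nbhd E (first_in xs S)) E xs)"
proof -
  have "cw_pivot S E xs 0 = first_in xs S"
    by (simp add: cw_pivot_def)
  moreover have "cw_pivot S E xs (Suc i) = cw_pivot (S \<inter> nbhd E (first_in xs S)) E xs i" for i
    unfolding cw_pivot_def cw_set_Suc_shift[of S] ..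
  ultimately show ?thesis
    unfolding cw_pivots_def
    by (subst Collect_index_shift) (use assms in \<open>simp add: cw_set_Suc_shift del: cw_set.simps(2)\<close>)
qed

lemma cw_blocks_rec:
  assumes "S \<noteq> {}"
  shows "cw_blocks S E xs = insert (S - nbhd E (first_in xs S))
    (cw_blocks (S \<inter> nbhd E (first_in xs S)) E xs)"
proof -
  have "cw_block S E xs 0 = S - nbhd E (first_in xs S)"
    by (auto simp: cw_block_def)
  moreover have "cw_block S E xs (Suc i) = cw_block (S \<inter> nbhd E (first_in xs S)) E xs i" for i
    unfolding cw_block_def cw_set_Suc_shift[of S] ..
  ultimately show ?thesis
    unfolding cw_blocks_def
    by (subst Collect_index_shift) (use assms in \<open>simp add: cw_set_Suc_shift del: cw_set.simps(2)\<close>)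
qed

lemma cw_pivots_subset:
  assumes "S \<subseteq> set xs"
  shows "cw_pivots S E xs \<subseteq> S"
proof
  fix x assume "x \<in> cw_pivots S E xs"
  then obtain i where i: "x = first_in xs (cw_set S E xs i)" "cw_set S E xs i \<noteq> {}"
    by (auto simp: cw_pivots_def cw_pivot_def)
  moreover have "cw_set S E xs i \<subseteq> set xs"
    using cw_set_subset[of S E xs i] assms by blast
  ultimately have "x \<in> cw_set S E xs i"
    by (auto intro: first_in_mem)
  then show "x \<in> S"
    using cw_set_subset[of S E xs i] by blast
qed

lemma cw_block_subset: "A \<in> cw_blocks S E xs \<Longrightarrow> A \<subseteq> S"
  using cw_set_subset[of S E xs] unfolding cw_blocks_def cw_block_def by blast

text \<open>Every step removes at least its pivot, which is not its own neighbour, so the process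
  exhausts the finite set \<open>S\<close>.\<close>

lemma Union_cw_blocks:
  assumes "finite S" and "S \<subseteq> set xs" and irrefl: "\<And>w. w \<notin> nbhd E w"
  shows "\<Union>(cw_blocks S E xs) = S"
  using assms(1,2)
proof (induction rule: finite_psubset_induct)
  case (psubset S)
  show ?case
  proof (cases "S = {}")
    case True
    have "cw_set {} E xs i = {}" for i
      using cw_set_subset[of "{}" E xs i] by simp
    with True show ?thesis
      by (simp add: cw_blocks_def)
  next
    case False
    define x where "x = first_in xs S"
    have "x \<in> S"
      using first_in_mem[OF psubset.prems False] by (simp add: x_def)
    then have "S \<inter> nbhd E x \<subset> S"
      using irrefl by blast
    then have "\<Union>(cw_blocks (S \<inter> nbhd E x) E xs) = S \<inter> nbhd E x"
      using psubset by blast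
    then show ?thesis
      using cw_blocks_rec[OF False, of E xs] by (auto simp: x_def)
  qed
qed

text \<open>The first block is \<open>S - nbhd E x\<close>, and the later ones cover exactly the
  rest. Hence two vertices missing \<open>nbhd E x\<close> share a block, and if just one misses it
  they are separated.\<close>

lemma separated_rec:
  assumes "finite S" and "S \<subseteq> set xs" and irrefl: "\<And>w. w \<notin> nbhd E w"
    and u: "u \<in> S" and v: "v \<in> S"
  defines "x \<equiv> first_in xs S"
  shows "separated S E xs u v \<longleftrightarrow>
    (if u \<in> nbhd E x \<and> v \<in> nbhd E x then separated (S \<inter> nbhd E x) E xs u v
     else u \<in> nbhd E x \<or> v \<in> nbhd E x)"
proof -
  define T where "T = S \<inter> nbhd E x"
  have blocks: "cw_blocks S E xs = insert (S - nbhd E x) (cw_blocks T E xs)"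
    using cw_blocks_rec[of S E xs] u by (auto simp: x_def T_def)
  have sub: "\<And>A. A \<in> cw_blocks T E xs \<Longrightarrow> A \<subseteq> nbhd E x"
    using cw_block_subset[of _ T E xs] unfolding T_def by blast
  have "\<Union>(cw_blocks T E xs) = T"
    using assms(1,2) irrefl by (intro Union_cw_blocks) (auto simp: T_def)
  then have cover: "\<And>w. w \<in> S \<Longrightarrow> w \<in> nbhd E x \<Longrightarrow> \<exists>A\<in>cw_blocks T E xs. w \<in> A"
    unfolding T_def by blast
  consider "u \<in> nbhd E x" "v \<in> nbhd E x" | "u \<in> nbhd E x" "v \<notin> nbhd E x"
    | "u \<notin> nbhd E x" "v \<in> nbhd E x" | "u \<notin> nbhd E x" "v \<notin> nbhd E x"
    by blast
  then show ?thesis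
  proof cases
    case 1
    then have "separated S E xs u v \<longleftrightarrow> separated T E xs u v"
      unfolding separated_def blocks by blast
    with 1 show ?thesis by (simp add: T_def)
  next
    case 2
    with cover[OF u] obtain A where "A \<in> cw_blocks T E xs" "u \<in> A" by blast
    with 2 v have "separated S E xs u v"
      unfolding separated_def blocks
      by (intro bexI[of _ A] bexI[of _ "S - nbhd E x"]) auto
    with 2 show ?thesis by simp
  next
    case 3
    with cover[OF v] obtain B where "B \<in> cw_blocks T E xs" "v \<in> B" by blast
    with 3 u have "separated S E xs u v"
      unfolding separated_def blocks
      by (intro bexI[of _ "S - nbhd E x"] bexI[of _ B]) auto
    with 3 show ?thesis by simp
  next
    case 4
    then have "A = S - nbhd E x" if "A \<in> cw_blocks S E xs" "u \<in> A \<or> v \<in> A" for A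
      using that sub[of A] unfolding blocks by blast
    then have "\<not> separated S E xs u v"
      unfolding separated_def by blast
    with 4 show ?thesis by simp
  qed
qed

section \<open>Recursion for the probabilities\<close>

lemma sep_prob_altdef:
  "sep_prob S E u v = measure_pmf.prob (random_ordering S) {xs. separated S E xs u v}"
  by (simp add: sep_prob_def separated_def)

text \<open>A uniform ordering is a uniform first element followed by a uniform ordering of the
  rest.\<close>

lemma prob_random_ordering_head:
  assumes "finite S" and "S \<noteq> {}"
  shows "real (card S) * measure_pmf.prob (random_ordering S) A
    = (\<Sum>x\<in>S. measure_pmf.prob (random_ordering (S - {x})) {ys. x # ys \<in> A})"
proof -
  have "measure_pmf.prob (random_ordering S) A
      = measure_pmf.expectation (pmf_of_set S \<bind>
          (\<lambda>x. map_pmf ((#) x) (random_ordering (S - {x})))) (indicator A)"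
    unfolding random_ordering_def random_permutation_of_set[OF assms] map_pmf_def by simp
  also have "\<dots> = (\<Sum>x\<in>S. measure_pmf.prob (random_ordering (S - {x})) {ys. x # ys \<in> A} / card S)"
  proof (subst pmf_expectation_bind_pmf_of_set)
    show "finite (set_pmf (map_pmf ((#) x) (random_ordering (S - {x}))))" for x
      using assms by (simp add: random_ordering_def)
  next
    have "measure_pmf.expectation (map_pmf ((#) x) (random_ordering (S - {x}))) (indicator A)
        = measure_pmf.prob (random_ordering (S - {x})) {ys. x # ys \<in> A}" for x
    proof -
      have "measure_pmf.expectation (map_pmf ((#) x) (random_ordering (S - {x}))) (indicator A)
        = measure_pmf.prob (map_pmf ((#) x) (random_ordering (S - {x}))) A"
        by simp
      then show ?thesis
        by (simp add: vimage_def)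
    qed
    then show "(\<Sum>x\<in>S. measure_pmf.expectation (map_pmf ((#) x) (random_ordering (S - {x})))
          (indicator A) /\<^sub>R real (card S))
        = (\<Sum>x\<in>S. measure_pmf.prob (random_ordering (S - {x})) {ys. x # ys \<in> A} / card S)"
      by (simp add: divide_inverse_commute)
  qed (use assms in auto)
  finally show ?thesis
    using assms by (simp add: sum_divide_distrib[symmetric])
qed

lemma map_filter_random_ordering:
  assumes "finite S" and "T \<subseteq> S"
  shows "map_pmf (filter (\<lambda>x. x \<in> T)) (random_ordering S) = random_ordering T"
proof -
  \<comment> \<open>Partitioning a uniform ordering yields a product of uniform orderings of the two
    parts; filtering is its first marginal.\<close>
  have "map_pmf (filter (\<lambda>x. x \<in> T)) (random_ordering S)
      = map_pmf fst (map_pmf (partition (\<lambda>x. x \<in> T)) (random_ordering S))"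
    by (simp add: pmf.map_comp o_def)
  also have "\<dots> = random_ordering {x \<in> S. x \<in> T}"
    unfolding random_ordering_def partition_random_permutations[OF assms(1)]
    by (rule map_fst_pair_pmf)
  also have "{x \<in> S. x \<in> T} = T"
    using assms by blast
  finally show ?thesis .
qed

text \<open>Such a \<open>P\<close> ignores the head \<open>x\<close>, which is outside
  \<open>T\<close>, and everything else outside \<open>T\<close>. This turns a probability
  conditioned on the first pivot into one for the process on \<open>T\<close>.\<close>

lemma prob_filter_random_ordering:
  assumes "finite S" and "T \<subseteq> S - {x}" and "\<And>xs. P (filter (\<lambda>x. x \<in> T) xs) = P xs"
  shows "measure_pmf.prob (random_ordering (S - {x})) {ys. P (x # ys)}
    = measure_pmf.prob (random_ordering T) {ys. P ys}"
proof -
  have "P (x # ys) \<longleftrightarrow> P ys" for ys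
  proof -
    have "filter (\<lambda>x. x \<in> T) (x # ys) = filter (\<lambda>x. x \<in> T) ys"
      using assms(2) by auto
    then show ?thesis
      using assms(3) by metis
  qed
  moreover have "measure_pmf.prob (random_ordering T) {ys. P ys}
      = measure_pmf.prob (random_ordering (S - {x})) {ys. P ys}"
    using assms by (simp add: map_filter_random_ordering[of "S - {x}" T, symmetric] vimage_def)
  ultimately show ?thesis by simp
qed

lemma set_pmf_random_ordering:
  "finite S \<Longrightarrow> set_pmf (random_ordering S) = permutations_of_set S"
  by (simp add: random_ordering_def)

lemma first_in_Cons: "x \<in> S \<Longrightarrow> first_in (x # xs) S = x"
  by (simp add: first_in_def)

text \<open>By the first vertex \<open>x\<close>: \<open>x = v\<close> contributes 1, any other
  non-neighbour 0 because \<open>v\<close> leaves in the first block, and a neighbour leaves the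
  process on \<open>S \<inter> nbhd E x\<close>.\<close>

lemma pivot_prob_rec:
  assumes "finite S" and irrefl: "\<And>w. w \<notin> nbhd E w" and v: "v \<in> S"
  shows "real (card S) * pivot_prob S E v
    = 1 + (\<Sum>x\<in>S \<inter> nbhd E v. pivot_prob (S \<inter> nbhd E x) E v)"
proof -
  let ?P = "\<lambda>x. measure_pmf.prob (random_ordering (S - {x})) {ys. v \<in> cw_pivots S E (x # ys)}"
  have rec: "v \<in> cw_pivots S E (x # ys) \<longleftrightarrow> v = x \<or> v \<in> cw_pivots (S \<inter> nbhd E x) E (x # ys)"
    if "x \<in> S" for x ys
    using cw_pivots_rec[of S E "x # ys"] that by (auto simp: first_in_Cons)
  have nonadj: "?P x = 0" if x: "x \<in> S - nbhd E v - {v}" for x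
  proof -
    have "v \<notin> cw_pivots S E (x # ys)" if "ys \<in> set_pmf (random_ordering (S - {x}))" for ys
    proof -
      have "set ys = S - {x}"
        using that assms by (auto simp: set_pmf_random_ordering permutations_of_setD)
      then have "cw_pivots (S \<inter> nbhd E x) E (x # ys) \<subseteq> S \<inter> nbhd E x"
        by (intro cw_pivots_subset) auto
      then show ?thesis
        using rec[of x ys] x nbhd_commute[of v E x] by auto
    qed
    then show ?thesis
      by (auto simp: measure_pmf_zero_iff)
  qed
  have adj: "?P x = pivot_prob (S \<inter> nbhd E x) E v" if x: "x \<in> S \<inter> nbhd E v" for x
  proof -
    have "v \<noteq> x"
      using x irrefl by blast
    then have "?P x = measure_pmf.prob (random_ordering (S - {x}))
        {ys. v \<in> cw_pivots (S \<inter> nbhd E x) E (x # ys)}"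
      using rec x by simp
    also have "\<dots> = pivot_prob (S \<inter> nbhd E x) E v"
      unfolding pivot_prob_def
      using assms(1) irrefl by (intro prob_filter_random_ordering) (auto simp only: cw_pivots_filter)
    finally show ?thesis .
  qed
  have self: "?P v = 1"
    using rec[OF v] by simp
  have "real (card S) * pivot_prob S E v = (\<Sum>x\<in>S. ?P x)"
    unfolding pivot_prob_def using v assms(1) by (subst prob_random_ordering_head) auto
  also have "\<dots> = (\<Sum>x\<in>insert v (S \<inter> nbhd E v). ?P x)"
    using assms(1) v nonadj by (intro sum.mono_neutral_right) auto
  also have "\<dots> = 1 + (\<Sum>x\<in>S \<inter> nbhd E v. ?P x)"
    using assms(1) irrefl self by simp
  finally show ?thesis
    using adj by simp
qed

text \<open>By the first vertex \<open>x\<close>: adjacent to neither contributes 0, to exactly one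
  contributes 1, to both leaves the smaller process. The cardinality counts those adjacent to
  \<open>u\<close> only.\<close>

lemma sep_prob_rec:
  assumes "finite S" and irrefl: "\<And>w. w \<notin> nbhd E w" and v: "v \<in> S" and u: "u \<in> S"
  shows "real (card S) * sep_prob S E v u
    = real (card (S \<inter> nbhd E u - nbhd E v))
      + (\<Sum>x\<in>S \<inter> nbhd E v. if x \<in> nbhd E u then sep_prob (S \<inter> nbhd E x) E v u else 1)"
proof -
  let ?P = "\<lambda>x. measure_pmf.prob (random_ordering (S - {x})) {ys. separated S E (x # ys) v u}"
  have P: "?P x = measure_pmf.prob (random_ordering (S - {x}))
      {ys. if v \<in> nbhd E x \<and> u \<in> nbhd E x then separated (S \<inter> nbhd E x) E (x # ys) v u
        else v \<in> nbhd E x \<or> u \<in> nbhd E x}" if x: "x \<in> S" for x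
  \<comment> \<open>The recursion needs \<open>S \<subseteq> set (x # ys)\<close>, so the two events
    agree only on the support of the random ordering.\<close>
  proof (rule measure_eq_AE)
    show "AE ys in random_ordering (S - {x}).
        (ys \<in> {ys. separated S E (x # ys) v u}) =
        (ys \<in> {ys. if v \<in> nbhd E x \<and> u \<in> nbhd E x then separated (S \<inter> nbhd E x) E (x # ys) v u
        else v \<in> nbhd E x \<or> u \<in> nbhd E x})"
    proof (rule AE_pmfI)
      fix ys assume "ys \<in> set_pmf (random_ordering (S - {x}))"
      then have "set ys = S - {x}"
        using assms by (auto simp: set_pmf_random_ordering permutations_of_setD)
      then have "S \<subseteq> set (x # ys)"
        by auto
      from separated_rec[OF assms(1) this irrefl v u, unfolded first_in_Cons[OF x]]
      show "(ys \<in> {ys. separated S E (x # ys) v u}) =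
        (ys \<in> {ys. if v \<in> nbhd E x \<and> u \<in> nbhd E x then separated (S \<inter> nbhd E x) E (x # ys) v u
        else v \<in> nbhd E x \<or> u \<in> nbhd E x})"
        by simp
    qed
  qed auto
  have adj: "?P x = (if x \<in> nbhd E u then sep_prob (S \<inter> nbhd E x) E v u else 1)"
    if x: "x \<in> S \<inter> nbhd E v" for x
  proof (cases "x \<in> nbhd E u")
    case True
    have "?P x = measure_pmf.prob (random_ordering (S - {x}))
        {ys. separated (S \<inter> nbhd E x) E (x # ys) v u}"
      using P[of x] x True nbhd_commute[of x E] by simp
    also have "\<dots> = sep_prob (S \<inter> nbhd E x) E v u"
      unfolding sep_prob_altdef
      using assms(1) irrefl by (intro prob_filter_random_ordering) (auto simp only: separated_filter)
    finally show ?thesis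
      using True by simp
  next
    case False
    then show ?thesis
      using P[of x] x nbhd_commute[of x E] by simp
  qed
  have nonadj: "?P x = of_bool (x \<in> nbhd E u)" if "x \<in> S - nbhd E v" for x
    using P[of x] that nbhd_commute[of x E] by simp
  have "real (card S) * sep_prob S E v u = (\<Sum>x\<in>S. ?P x)"
    unfolding sep_prob_altdef using v assms(1) by (subst prob_random_ordering_head) auto
  also have "\<dots> = (\<Sum>x\<in>S \<inter> nbhd E v. ?P x) + (\<Sum>x\<in>S - nbhd E v. ?P x)"
    by (rule sum.Int_Diff[OF assms(1)])
  also have "(\<Sum>x\<in>S - nbhd E v. ?P x) = real (card ((S - nbhd E v) \<inter> nbhd E u))"
    using assms(1) nonadj by (simp add: of_bool_def sum.If_cases)
  also have "(S - nbhd E v) \<inter> nbhd E u = S \<inter> nbhd E u - nbhd E v"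
    by blast
  finally show ?thesis
    using adj by simp
qed

section \<open>Positivity of the probabilities and of the coefficients \<open>m\<close>\<close>

lemma pivot_prob_pos:
  assumes "finite S" and "\<And>w. w \<notin> nbhd E w" and "v \<in> S"
  shows "pivot_prob S E v > 0"
proof -
  have "0 \<le> (\<Sum>x\<in>S \<inter> nbhd E v. pivot_prob (S \<inter> nbhd E x) E v)"
    by (intro sum_nonneg) (simp add: pivot_prob_def)
  then have "real (card S) * pivot_prob S E v > 0"
    using pivot_prob_rec[OF assms] by simp
  then show ?thesis
    by (simp add: zero_less_mult_iff)
qed

text \<open>The vertex \<open>v\<close> itself is counted: it is adjacent to \<open>u\<close> but
  not to itself.\<close>

lemma card_private_nbhd_pos:
  assumes "finite S" and "\<And>w. w \<notin> nbhd E w" and "v \<in> S" and "u \<in> nbhd E v"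
  shows "card (S \<inter> nbhd E u - nbhd E v) > 0"
proof -
  have "v \<in> S \<inter> nbhd E u - nbhd E v"
    using assms nbhd_commute[of u E v] by auto
  then show ?thesis
    using assms(1) by (auto simp: card_gt_0_iff)
qed

lemma sep_prob_pos:
  assumes "finite S" and "\<And>w. w \<notin> nbhd E w" and "v \<in> S" and "u \<in> S" and "u \<in> nbhd E v"
  shows "sep_prob S E v u > 0"
proof -
  have "0 \<le> (\<Sum>x\<in>S \<inter> nbhd E v. if x \<in> nbhd E u then sep_prob (S \<inter> nbhd E x) E v u else 1)"
    by (intro sum_nonneg) (simp add: sep_prob_def)
  then have "real (card S) * sep_prob S E v u > 0"
    using sep_prob_rec[OF assms(1-4)] card_private_nbhd_pos[OF assms(1-3,5)] by simp
  then show ?thesis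
    by (simp add: zero_less_mult_iff)
qed

section \<open>Induction on the vertex set\<close>

text \<open>The edge set stays fixed while the vertex set shrinks to \<open>S \<inter> nbhd E x\<close>; this stands for
  passing to the induced subgraph, so edges may leave \<open>S\<close>.\<close>

theorem caro_wei_inequality:
  assumes "finite S" and irrefl: "\<And>w. w \<notin> nbhd E w" and "v \<in> S"
  shows "1 / pivot_prob S E v + (\<Sum>u\<in>S \<inter> nbhd E v. 1 / sep_prob S E v u) \<le> real (card S)"
  using assms(1,3)
proof (induction rule: finite_psubset_induct)
  case (psubset S)
  note fin = \<open>finite S\<close> and v = \<open>v \<in> S\<close>
  define N where "N = S \<inter> nbhd E v"
  define n where "n = real (card S)"
  define m where "m x = real (card (S \<inter> nbhd E x - nbhd E v))" for x
  define p where "p x = pivot_prob (S \<inter> nbhd E x) E v" for x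
  define q where "q x u = (if x \<in> nbhd E u then sep_prob (S \<inter> nbhd E x) E v u else 1)" for x u
  have N: "finite N" "\<And>x. x \<in> N \<Longrightarrow> x \<in> S \<and> x \<in> nbhd E v \<and> v \<in> nbhd E x"
    using fin nbhd_commute[of v E] by (auto simp: N_def)
  have n: "n > 0"
    using fin v by (auto simp: n_def card_gt_0_iff)
  have np: "n * pivot_prob S E v = 1 + (\<Sum>x\<in>N. p x)"
    unfolding n_def N_def p_def by (rule pivot_prob_rec[OF fin irrefl v])
  have nq: "n * sep_prob S E v u = m u + (\<Sum>x\<in>N. q x u)" if "u \<in> N" for u
    unfolding n_def N_def m_def q_def using N(2)[OF that] by (intro sep_prob_rec fin irrefl v) simp
  have budget: "1 / p x + (\<Sum>u\<in>N. 1 / q x u) \<le> m x + card N" if x: "x \<in> N" for x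
  proof -
    have "x \<in> S" "x \<notin> nbhd E x" "v \<in> S \<inter> nbhd E x"
      using N(2)[OF x] irrefl v by auto
    then have "1 / p x + (\<Sum>u\<in>S \<inter> nbhd E x \<inter> nbhd E v. 1 / sep_prob (S \<inter> nbhd E x) E v u)
        \<le> card (S \<inter> nbhd E x)"
      unfolding p_def by (intro psubset.IH) auto
    also have "S \<inter> nbhd E x \<inter> nbhd E v = N \<inter> nbhd E x"
      by (auto simp: N_def)
    also have "(\<Sum>u\<in>N \<inter> nbhd E x. 1 / sep_prob (S \<inter> nbhd E x) E v u)
        = (\<Sum>u\<in>N \<inter> nbhd E x. 1 / q x u)"
      using nbhd_commute[of x E] by (intro sum.cong) (auto simp: q_def)
    finally have 1: "1 / p x + (\<Sum>u\<in>N \<inter> nbhd E x. 1 / q x u) \<le> card (S \<inter> nbhd E x)" .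
    \<comment> \<open>The default value 1 of \<open>q\<close> adds
      \<open>card (N - nbhd E x)\<close> to both sides of the induction hypothesis. As
      \<open>card (S \<inter> nbhd E x)\<close> is \<open>card (N \<inter> nbhd E x) + m x\<close>,
      its right side becomes \<open>m x + card N\<close>.\<close>
    have 2: "(\<Sum>u\<in>N - nbhd E x. 1 / q x u) = card (N - nbhd E x)"
      using nbhd_commute[of x E] by (simp add: q_def)
    have "(\<Sum>u\<in>N. 1 / q x u)
        = (\<Sum>u\<in>N \<inter> nbhd E x. 1 / q x u) + (\<Sum>u\<in>N - nbhd E x. 1 / q x u)"
      by (rule sum.Int_Diff[OF N(1)])
    moreover have "card N = card (N \<inter> nbhd E x) + card (N - nbhd E x)"
      using N(1) by (metis card_Int_Diff)
    moreover have "card (S \<inter> nbhd E x)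
        = card (S \<inter> nbhd E x \<inter> nbhd E v) + card (S \<inter> nbhd E x - nbhd E v)"
      using fin by (intro card_Int_Diff) simp
    moreover have "S \<inter> nbhd E x \<inter> nbhd E v = N \<inter> nbhd E x"
      by (auto simp: N_def)
    ultimately show ?thesis
      using 1 2 by (simp add: m_def)
  qed
  have "1 / (1 + (\<Sum>x\<in>N. p x)) + (\<Sum>u\<in>N. 1 / (m u + (\<Sum>x\<in>N. q x u))) \<le> 1"
  proof (rule sum_inverse_le_one[OF N(1) _ _ _ _ budget])
    fix x assume x: "x \<in> N"
    show "m x > 0"
      unfolding m_def using card_private_nbhd_pos[OF fin irrefl v] N(2)[OF x] by auto
    show "p x > 0"
      unfolding p_def using fin irrefl v N(2)[OF x] by (intro pivot_prob_pos) auto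
    fix u assume u: "u \<in> N"
    show "q x u > 0"
      unfolding q_def using fin irrefl v N(2)[OF x] N(2)[OF u] nbhd_commute[of x E u]
      by (auto intro!: sep_prob_pos)
    show "q x u \<le> 1"
      by (simp add: q_def sep_prob_def)
  qed
  \<comment> \<open>Both recursions carry the factor \<open>n\<close>, so the bound 1 scales to
    \<open>n\<close>.\<close>
  then have "n * (1 / (n * pivot_prob S E v) + (\<Sum>u\<in>N. 1 / (n * sep_prob S E v u))) \<le> n * 1"
    unfolding np using n nq by (intro mult_left_mono) auto
  then show ?case
    using n unfolding N_def[symmetric] n_def[symmetric]
    by (simp add: distrib_left sum_distrib_left)
qed

theorem lemma1p6:
  fixes V :: "'a set" and E :: "'a set set" and v :: 'a and n :: nat
  assumes "finite_simple_graph V E"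
    and "card V = n" and "n \<ge> 1"
    and "v \<in> V"
  shows "1 / pivot_prob V E v + (\<Sum>u\<in>nbhd E v. 1 / sep_prob V E v u) \<le> real n"
proof -
  have "finite V" and E: "\<And>e. e \<in> E \<Longrightarrow> e \<subseteq> V \<and> card e = 2"
    using assms(1) by (auto simp: finite_simple_graph_def)
  moreover have "w \<notin> nbhd E w" for w
    \<comment> \<open>A loop at \<open>w\<close> would be the edge \<open>{w, w} = {w}\<close>,
      which has cardinality 1.\<close>
    using E[of "{w}"] by (auto simp: nbhd_def)
  moreover have "V \<inter> nbhd E v = nbhd E v"
    using E by (fastforce simp: nbhd_def)
  ultimately show ?thesis
    using caro_wei_inequality[of V E v] assms by simp
qed

end
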